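(* Let $R$ be a dedekind type domain, let $\mathit{M}(R)$ be the monoid of ideals generated by the maximal ideals of $R$, let $k\geq 2$, and let $\mathcal{I}_1,\dots,\mathcal{I}_k\in\mathit{M}(R)$ be pairwise comaximal ideals. Then the maps $$\sigma_1,\sigma_2:SL_k(R)\to\mathbb{PF}^{k-1}_{\mathcal{I}_1}\times\cdots\times\mathbb{PF}^{k-1}_{\mathcal{I}_k}$$ given, for $A=[a_{ij}]$ with $\det A=1$, by $\sigma_1(A)=([a_{11}:\dots:a_{1k}],\dots,[a_{k1}:\dots:a_{kk}])$ (rows) and $\sigma_2(A)=([a_{11}:\dots:a_{k1}],\dots,[a_{1k}:\dots:a_{kk}])$ (columns) are surjective.
   Context: A commutative ring $R$ with unity is a dedekind type domain if it is a field, or if every maximal ideal $\mathcal{M}$ satisfies: (1) $\mathcal{M}^i\neq\mathcal{M}^{i+1}$ for all $i\ge0$; (2) $\bigcap_{i\ge0}\mathcal{M}^i=(0)$; (3) $\dim_{R/\mathcal{M}}(\mathcal{M}^i/\mathcal{M}^{i+1})=1$ for all $i\geq 0$; and moreover (4) every nonzero element of $R$ lies in only finitely many maximal ideals. $\mathit{M}(R)$ is the set of finite products of maximal ideals (including $R$ as the empty product). A tuple $(a_0,\dots,a_n)\in R^{n+1}$ is unital if $(a_0,\dots,a_n)=R$. For an ideal $\mathcal{I}\in\mathit{M}(R)$, on unital tuples in $R^{n+1}$ set $(a_i)\sim(b_i)$ iff $a_ib_j-a_jb_i\in\mathcal{I}$ for all $i<j$ (an equivalence relation); $[a_0:\dots:a_n]$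 denotes the class and $\mathbb{PF}^n_{\mathcal{I}}$ the set of classes. *)

theory Defs
  imports
    "Jordan_Normal_Form.VS_Connect"
    "HOL-Algebra.Ideal_Product"
    "HOL-Algebra.QuotRing"
begin

section \<open>Dedekind type domains\<close>

abbreviation ideal_power :: "('a, 'b) ring_scheme \<Rightarrow> 'a set \<Rightarrow> nat \<Rightarrow> 'a set" where
  "ideal_power R M i \<equiv> M [^]\<^bsub>ideals_set R\<^esub> i"

text \<open>
  The module \<open>I / J\<close> over \<open>R / M\<close>, for ideals \<open>J \<subseteq> I\<close> with \<open>M I \<subseteq> J\<close>. In that case
  \<open>rcoset_mult R J\<close> sends \<open>r + M\<close> and \<open>x + J\<close> to the coset \<open>r x + J\<close>, so it serves as
  scalar multiplication. The fields \<open>mult\<close> and \<open>one\<close> of the record play no role for modules.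
\<close>

definition ideal_quotient :: "('a, 'b) ring_scheme \<Rightarrow> 'a set \<Rightarrow> 'a set \<Rightarrow> ('a set, 'a set) module" where
  "ideal_quotient R I J =
    \<lparr>carrier = {J +>\<^bsub>R\<^esub> x |x. x \<in> I}, mult = undefined, one = undefined,
     zero = J, add = set_add R, smult = rcoset_mult R J\<rparr>"

definition dedekind_type_domain :: "('a, 'b) ring_scheme \<Rightarrow> bool" where
  "dedekind_type_domain R \<longleftrightarrow> cring R \<and>
    (field R \<or>
      (\<forall>M. maximalideal M R \<longrightarrow>
         (\<forall>i. ideal_power R M i \<noteq> ideal_power R M (Suc i)) \<and>
         (\<Inter>i. ideal_power R M i) = {\<zero>\<^bsub>R\<^esub>} \<and>
         (\<forall>i. let V = ideal_quotient R (ideal_power R M i) (ideal_power R M (Suc i))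
              in vectorspace.fin_dim (R Quot M) V \<and> vectorspace.dim (R Quot M) V = 1)) \<and>
      (\<forall>x \<in> carrier R - {\<zero>\<^bsub>R\<^esub>}. finite {M. maximalideal M R \<and> x \<in> M}))"

inductive_set maximal_ideal_monoid :: "('a, 'b) ring_scheme \<Rightarrow> 'a set set"
  for R :: "('a, 'b) ring_scheme" where
  unit: "carrier R \<in> maximal_ideal_monoid R"
| mult: "I \<in> maximal_ideal_monoid R \<Longrightarrow> maximalideal M R \<Longrightarrow> I \<cdot>\<^bsub>R\<^esub> M \<in> maximal_ideal_monoid R"

section \<open>The sets \<open>\<P>\<F>\<^sup>n\<^sub>I\<close>\<close>

definition unital_tuples :: "nat \<Rightarrow> 'a::comm_ring_1 vec set" where
  "unital_tuples n = {a \<in> carrier_vec (n + 1). Idl\<^bsub>class_ring\<^esub> (set\<^sub>v a) = UNIV}"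

definition proj_rel :: "nat \<Rightarrow> 'a::comm_ring_1 set \<Rightarrow> ('a vec \<times> 'a vec) set" where
  "proj_rel n I = {(a, b). a \<in> unital_tuples n \<and> b \<in> unital_tuples n \<and>
     (\<forall>i j. i < j \<and> j \<le> n \<longrightarrow> a $ i * b $ j - a $ j * b $ i \<in> I)}"

definition PF :: "nat \<Rightarrow> 'a::comm_ring_1 set \<Rightarrow> 'a vec set set" where
  "PF n I = unital_tuples n // proj_rel n I"

definition proj_class :: "nat \<Rightarrow> 'a::comm_ring_1 set \<Rightarrow> 'a vec \<Rightarrow> 'a vec set" where
  "proj_class n I a = proj_rel n I `` {a}"

section \<open>The row and column maps on \<open>SL\<^sub>k(R)\<close>\<close>

definition SL :: "nat \<Rightarrow> 'a::comm_ring_1 mat set" where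
  "SL k = {A \<in> carrier_mat k k. det A = 1}"

definition sigma1 :: "nat \<Rightarrow> (nat \<Rightarrow> 'a::comm_ring_1 set) \<Rightarrow> 'a mat \<Rightarrow> nat \<Rightarrow> 'a vec set" where
  "sigma1 k I A = (\<lambda>i\<in>{..<k}. proj_class (k - 1) (I i) (row A i))"

definition sigma2 :: "nat \<Rightarrow> (nat \<Rightarrow> 'a::comm_ring_1 set) \<Rightarrow> 'a mat \<Rightarrow> nat \<Rightarrow> 'a vec set" where
  "sigma2 k I A = (\<lambda>i\<in>{..<k}. proj_class (k - 1) (I i) (col A i))"

end

theory Submission
  imports Defs
begin

text \<open>
  A unital tuple can be moved to a tuple congruent to a unit vector modulo \<open>I\<close> by elementary
  column operations: one first makes some coordinate invertible modulo \<open>I\<close>, adjoining the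
  maximal factors of \<open>I\<close> one at a time, and then clears the other coordinates. As the ideals
  \<open>I\<^sub>i\<close> are pairwise comaximal, a column operation on a matrix can be chosen to act in a prescribed
  way on row \<open>i\<close> modulo \<open>I\<^sub>i\<close> and trivially on row \<open>j\<close> modulo \<open>I\<^sub>j\<close> for all \<open>j \<noteq> i\<close>. Running the
  reductions backwards from the identity matrix therefore realises all rows simultaneously.
\<close>

section \<open>Ideals of a commutative ring type\<close>

abbreviation cring_ideal :: "'a::comm_ring_1 set \<Rightarrow> bool" where
  "cring_ideal I \<equiv> ideal I (class_ring :: 'a ring)"

lemma cring_ideal_iff:
  "cring_ideal I \<longleftrightarrow> 0 \<in> I \<and> (\<forall>x\<in>I. \<forall>y\<in>I. x + y \<in> I) \<and> (\<forall>x\<in>I. \<forall>r. r * x \<in> I)"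
proof
  assume "cring_ideal I"
  then interpret ideal I "class_ring :: 'a ring" .
  show "0 \<in> I \<and> (\<forall>x\<in>I. \<forall>y\<in>I. x + y \<in> I) \<and> (\<forall>x\<in>I. \<forall>r. r * x \<in> I)"
    using zero_closed a_closed I_l_closed by simp
next
  assume I: "0 \<in> I \<and> (\<forall>x\<in>I. \<forall>y\<in>I. x + y \<in> I) \<and> (\<forall>x\<in>I. \<forall>r. r * x \<in> I)"
  have neg: "- x \<in> I" if "x \<in> I" for x
    using I that by (metis mult_minus1)
  show "cring_ideal I"
  proof (rule idealI)
    show "ring (class_ring :: 'a ring)"
      by (rule class_ring.ring_axioms)
    have G: "group (add_monoid (class_ring :: 'a ring))"
      by (rule abelian_group.a_group[OF ring.is_abelian_group[OF class_ring.ring_axioms]])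
    have "inv\<^bsub>add_monoid (class_ring :: 'a ring)\<^esub> a = - a" for a
      by (rule group.inv_equality[OF G]) auto
    then show "subgroup I (add_monoid (class_ring :: 'a ring))"
      using I neg by (intro group.subgroupI[OF G]) auto
  qed (use I in \<open>auto simp: mult.commute\<close>)
qed

lemma cring_ideal_zero: "cring_ideal I \<Longrightarrow> 0 \<in> I"
  and cring_ideal_add: "cring_ideal I \<Longrightarrow> x \<in> I \<Longrightarrow> y \<in> I \<Longrightarrow> x + y \<in> I"
  and cring_ideal_mult_left: "cring_ideal I \<Longrightarrow> x \<in> I \<Longrightarrow> r * x \<in> I"
  by (simp_all add: cring_ideal_iff)

lemma cring_ideal_mult_right: "cring_ideal I \<Longrightarrow> x \<in> I \<Longrightarrow> x * r \<in> I"
  using cring_ideal_mult_left[of I x r] by (simp add: mult.commute)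

lemma cring_ideal_uminus: "cring_ideal I \<Longrightarrow> x \<in> I \<Longrightarrow> - x \<in> I"
  using cring_ideal_mult_left[of I x "-1"] by simp

lemma cring_ideal_diff: "cring_ideal I \<Longrightarrow> x \<in> I \<Longrightarrow> y \<in> I \<Longrightarrow> x - y \<in> I"
  using cring_ideal_add[of I x "- y"] cring_ideal_uminus[of I y] by simp

lemma cring_ideal_sum: "cring_ideal I \<Longrightarrow> (\<And>x. x \<in> A \<Longrightarrow> f x \<in> I) \<Longrightarrow> sum f A \<in> I"
  by (induction A rule: infinite_finite_induct) (auto simp: cring_ideal_zero cring_ideal_add)

lemmas cring_ideal_closed = cring_ideal_zero cring_ideal_add cring_ideal_mult_left
  cring_ideal_mult_right cring_ideal_uminus cring_ideal_diff

text \<open>The colon ideal \<open>(I : d)\<close>. If it contains every entry of a unital tuple it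
  contains 1, which puts \<open>d\<close> itself in \<open>I\<close>.\<close>

lemma cring_ideal_colon:
  fixes I :: "'a::comm_ring_1 set"
  assumes "cring_ideal I"
  shows "cring_ideal {r. r * d \<in> I}"
  unfolding cring_ideal_iff using assms
  by (auto simp: distrib_right mult.assoc cring_ideal_closed)

section \<open>Products of maximal ideals and comaximal families\<close>

lemma maximal_ideal_monoid_ideal:
  fixes I :: "'a::comm_ring_1 set"
  assumes "I \<in> maximal_ideal_monoid (class_ring :: 'a ring)"
  shows "cring_ideal I"
  using assms
proof induction
  case unit
  then show ?case by (simp add: cring_ideal_iff)
next
  case (mult I M)
  then show ?case
    using ring.ideal_prod_is_ideal[OF class_ring.ring_axioms] maximalideal.axioms(1) by blast
qed

text \<open>The ideal \<open>M + u R\<close> contains \<open>M\<close> and also \<open>u\<close>, so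
  maximality makes it the whole ring, and 1 lies in it.\<close>

lemma maximal_ideal_inverse:
  fixes M :: "'a::comm_ring_1 set"
  assumes "maximalideal M (class_ring :: 'a ring)" and "u \<notin> M"
  shows "\<exists>y. 1 - u * y \<in> M"
proof -
  interpret maximalideal M "class_ring :: 'a ring" by fact
  have M: "cring_ideal M" by (rule is_ideal)
  let ?J = "{m + u * y | m y. m \<in> M}"
  have "cring_ideal ?J"
    unfolding cring_ideal_iff
  proof (intro conjI ballI allI)
    show "0 \<in> ?J"
      using cring_ideal_zero[OF M] by (intro CollectI exI[of _ 0]) simp
  next
    fix a b assume "a \<in> ?J" "b \<in> ?J"
    then obtain m y n z where "m \<in> M" "n \<in> M" "a = m + u * y" "b = n + u * z" by auto
    then show "a + b \<in> ?J"
      using M by (intro CollectI exI[of _ "m + n"] exI[of _ "y + z"])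
        (simp add: cring_ideal_closed algebra_simps)
  next
    fix a r assume "a \<in> ?J"
    then obtain m y where "m \<in> M" "a = m + u * y" by auto
    then show "r * a \<in> ?J"
      using M by (intro CollectI exI[of _ "r * m"] exI[of _ "r * y"])
        (simp add: cring_ideal_closed algebra_simps)
  qed
  moreover have "M \<subseteq> ?J"
  proof
    fix m assume "m \<in> M"
    then show "m \<in> ?J" by (intro CollectI exI[of _ m] exI[of _ 0]) simp
  qed
  moreover have "u \<in> ?J"
    using cring_ideal_zero[OF M] by (intro CollectI exI[of _ 0] exI[of _ 1]) simp
  ultimately have "?J = M \<or> ?J = UNIV" and "u \<in> ?J"
    using I_maximal[of ?J] by (simp_all only: partial_object.simps subset_UNIV simp_thms)
  then have "1 \<in> ?J" using assms(2) by blast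
  then obtain m y where "m \<in> M" "1 = m + u * y" by blast
  then have "1 - u * y = m" by (metis add_diff_cancel_right')
  with \<open>m \<in> M\<close> show ?thesis by blast
qed

text \<open>The Chinese remainder element of index \<open>i\<close>. It starts as 1 and takes in the
  other ideals one at a time: from \<open>1 = x + y\<close> with \<open>x\<close> in
  \<open>I i\<close> and \<open>y\<close> in \<open>I m\<close>, the factor \<open>y\<close> puts
  \<open>e * y\<close> in \<open>I m\<close> and leaves the residue modulo \<open>I i\<close>
  unchanged.\<close>

lemma comaximal_separator:
  fixes I :: "nat \<Rightarrow> 'a::comm_ring_1 set"
  assumes ideals: "\<And>i. i < k \<Longrightarrow> cring_ideal (I i)"
    and comaximal: "\<And>i j. i < k \<Longrightarrow> j < k \<Longrightarrow> i \<noteq> j \<Longrightarrow> I i <+>\<^bsub>class_ring\<^esub> I j = UNIV"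
    and "i < k"
  obtains e where "1 - e \<in> I i" and "\<And>j. j < k \<Longrightarrow> j \<noteq> i \<Longrightarrow> e \<in> I j"
proof -
  have "\<exists>e. 1 - e \<in> I i \<and> (\<forall>j<m. j \<noteq> i \<longrightarrow> e \<in> I j)" if "m \<le> k" for m
    using that
  proof (induction m)
    case 0
    show ?case
      using ideals[OF \<open>i < k\<close>] by (intro exI[of _ 1]) (simp add: cring_ideal_zero)
  next
    case (Suc m)
    then obtain e where e: "1 - e \<in> I i" "\<forall>j<m. j \<noteq> i \<longrightarrow> e \<in> I j" by auto
    show ?case
    proof (cases "m = i")
      case True
      with e show ?thesis by (auto simp: less_Suc_eq)
    next
      case False
      with Suc.prems \<open>i < k\<close> have "1 \<in> I i <+>\<^bsub>class_ring\<^esub> I m"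
        using comaximal[of i m] by simp
      then obtain x y where xy: "x \<in> I i" "y \<in> I m" "1 = x + y"
        by (auto simp: set_add_def')
      have "(1 - e) + e * x \<in> I i"
        using e(1) xy(1) ideals[OF \<open>i < k\<close>] by (intro cring_ideal_add cring_ideal_mult_left)
      moreover have y: "y = 1 - x" using xy(3) by (metis add_diff_cancel_left')
      have "(1 - e) + e * x = 1 - e * y" unfolding y by (simp add: algebra_simps)
      ultimately have "1 - e * y \<in> I i" by metis
      moreover have "e * y \<in> I j" if "j < Suc m" "j \<noteq> i" for j
        using that e(2) xy(2) ideals[of j] Suc.prems
        by (cases "j = m") (auto simp: cring_ideal_closed)
      ultimately show ?thesis by blast
    qed
  qed
  from this[of k] show ?thesis using that by blast
qed

section \<open>Unital tuples\<close>

text \<open>Quantifying over all ideals, instead of naming the generated one, lets unitality be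
  applied at once to a maximal ideal, a colon ideal or the ideal generated by another tuple.\<close>

definition unital :: "nat \<Rightarrow> (nat \<Rightarrow> 'a::comm_ring_1) \<Rightarrow> bool" where
  "unital k v \<longleftrightarrow> (\<forall>J. cring_ideal J \<and> (\<forall>i<k. v i \<in> J) \<longrightarrow> 1 \<in> J)"

lemma unital_tuples_iff:
  "a \<in> unital_tuples n \<longleftrightarrow> a \<in> carrier_vec (n + 1) \<and> unital (n + 1) (($) a)"
proof -
  have one: "J = UNIV" if "cring_ideal J" "1 \<in> J" for J :: "'a set"
    using that by (metis UNIV_eq_I cring_ideal_mult_left mult.right_neutral)
  have "Idl\<^bsub>class_ring\<^esub> (set\<^sub>v a) = UNIV \<longleftrightarrow> unital (n + 1) (($) a)"
    if "a \<in> carrier_vec (n + 1)"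
  proof -
    have "set\<^sub>v a \<subseteq> J \<longleftrightarrow> (\<forall>i<n + 1. a $ i \<in> J)" for J
      using that by (auto simp: vec_set_def)
    then show ?thesis
      unfolding genideal_def unital_def using one by blast
  qed
  then show ?thesis unfolding unital_tuples_def by blast
qed

text \<open>Laplace expansion along row \<open>i\<close> writes 1 as a linear combination of the
  entries of that row.\<close>

lemma unital_row:
  fixes A :: "'a::comm_ring_1 mat"
  assumes "A \<in> SL k" and "i < k"
  shows "unital k (($) (row A i))"
  unfolding unital_def
proof (intro allI impI)
  fix J :: "'a set"
  assume J: "cring_ideal J \<and> (\<forall>j<k. row A i $ j \<in> J)"
  have A: "A \<in> carrier_mat k k" "det A = 1" using assms by (auto simp: SL_def)
  have "det A = (\<Sum>j<k. A $$ (i,j) * cofactor A i j)"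
    using A assms by (intro laplace_expansion_row)
  also have "\<dots> \<in> J"
    using J A assms by (intro cring_ideal_sum) (auto intro!: cring_ideal_mult_right)
  finally show "1 \<in> J" using A by simp
qed

section \<open>The projective relation modulo an ideal\<close>

lemma proj_rel_sym: "cring_ideal I \<Longrightarrow> (a, b) \<in> proj_rel n I \<Longrightarrow> (b, a) \<in> proj_rel n I"
  unfolding proj_rel_def using cring_ideal_uminus by (fastforce simp: mult.commute)

lemma proj_rel_minor:
  assumes "cring_ideal I" and "(a, b) \<in> proj_rel n I" and "i \<le> n" and "j \<le> n"
  shows "a $ i * b $ j - a $ j * b $ i \<in> I"
proof -
  consider "i < j" | "i = j" | "j < i" by linarith
  then show ?thesis
  proof cases
    case 3
    then have "- (a $ j * b $ i - a $ i * b $ j) \<in> I"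
      using assms by (intro cring_ideal_uminus) (auto simp: proj_rel_def)
    then show ?thesis by simp
  qed (use assms in \<open>auto simp: proj_rel_def cring_ideal_zero\<close>)
qed

text \<open>Every entry of the middle tuple \<open>b\<close> multiplies the minors of
  \<open>a\<close> and \<open>c\<close> into \<open>I\<close>. Since \<open>b\<close> is unital,
  these minors lie in \<open>I\<close>.\<close>

lemma proj_rel_trans:
  assumes I: "cring_ideal I" and ab: "(a, b) \<in> proj_rel n I" and bc: "(b, c) \<in> proj_rel n I"
  shows "(a, c) \<in> proj_rel n I"
proof -
  have "a $ i * c $ j - a $ j * c $ i \<in> I" if ij: "i < j" "j \<le> n" for i j
  proof -
    let ?d = "a $ i * c $ j - a $ j * c $ i"
    have "b $ l * ?d \<in> I" if "l < n + 1" for l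
    proof -
      have *: "a $ i * b $ l - a $ l * b $ i \<in> I" "b $ i * c $ j - b $ j * c $ i \<in> I"
        "a $ j * b $ l - a $ l * b $ j \<in> I"
        using that ij proj_rel_minor[OF I ab] proj_rel_minor[OF I bc] by auto
      \<comment> \<open>All terms containing \<open>a $ l\<close> cancel on the right, and each
        summand contains a minor of \<open>a, b\<close> or of \<open>b, c\<close>.\<close>
      have "b $ l * ?d = (a $ i * b $ l - a $ l * b $ i) * c $ j
          + a $ l * (b $ i * c $ j - b $ j * c $ i) - (a $ j * b $ l - a $ l * b $ j) * c $ i"
        by (simp add: algebra_simps)
      with * show ?thesis using I by (simp add: cring_ideal_closed)
    qed
    moreover have "unital (n + 1) (($) b)"
      using ab by (simp add: proj_rel_def unital_tuples_iff)
    ultimately have "1 \<in> {r. r * ?d \<in> I}"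
      using cring_ideal_colon[OF I, of ?d] unfolding unital_def by blast
    then show ?thesis by simp
  qed
  then show ?thesis using ab bc by (auto simp: proj_rel_def)
qed

text \<open>Passes from entrywise congruence, which is what the matrix construction delivers, to
  equality of projective points.\<close>

lemma proj_class_cong:
  assumes I: "cring_ideal I" and a: "a \<in> unital_tuples n" and b: "b \<in> unital_tuples n"
    and cong: "\<And>j. j \<le> n \<Longrightarrow> a $ j - b $ j \<in> I"
  shows "proj_class n I a = proj_class n I b"
proof -
  have "a $ i * b $ j - a $ j * b $ i \<in> I" if "i < j" "j \<le> n" for i j
  proof -
    have "a $ i * b $ j - a $ j * b $ i = (a $ i - b $ i) * b $ j - (a $ j - b $ j) * b $ i"
      by (simp add: algebra_simps)
    then show ?thesis
      using cong[of i] cong[of j] that I by (simp add: cring_ideal_closed)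
  qed
  then have "(a, b) \<in> proj_rel n I"
    using a b by (simp add: proj_rel_def)
  then show ?thesis
    unfolding proj_class_def using proj_rel_sym[OF I] proj_rel_trans[OF I] by blast
qed

section \<open>Elementary column operations on a row\<close>

text \<open>The orbit of a row under elementary matrices acting from the right. Positions from
  \<open>k\<close> on are never touched.\<close>

inductive col_ops :: "nat \<Rightarrow> (nat \<Rightarrow> 'a::comm_ring_1) \<Rightarrow> (nat \<Rightarrow> 'a) \<Rightarrow> bool" for k v where
  refl: "col_ops k v v"
| step: "col_ops k v w \<Longrightarrow> p < k \<Longrightarrow> q < k \<Longrightarrow> p \<noteq> q \<Longrightarrow> col_ops k v (w(p := w p + c * w q))"

lemma col_ops_trans:
  assumes "col_ops k u v" and "col_ops k v w"
  shows "col_ops k u w"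
  using assms(2,1) by induction (auto intro: col_ops.step)

text \<open>Each step is undone by the coefficient \<open>- c\<close>, because \<open>p\<close> and
  \<open>q\<close> differ. Reductions can thus be run backwards, from a unit vector to the given
  tuple.\<close>

lemma col_ops_sym:
  assumes "col_ops k v w"
  shows "col_ops k w v"
  using assms
proof induction
  case refl
  show ?case by (rule col_ops.refl)
next
  case (step w p q c)
  let ?w = "w(p := w p + c * w q)"
  have "col_ops k ?w (?w(p := ?w p + (- c) * ?w q))"
    using step by (intro col_ops.step col_ops.refl)
  also have "?w(p := ?w p + (- c) * ?w q) = w"
    using step by (auto simp: fun_eq_iff)
  finally show ?case using step.IH by (rule col_ops_trans)
qed

text \<open>The old entry \<open>w p\<close> is recovered from the new entries, so an ideal
  containing the new tuple contains the old one.\<close>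

lemma unital_col_ops:
  assumes "col_ops k v w" and "unital k v"
  shows "unital k w"
  using assms
proof induction
  case (step w p q c)
  then have w: "unital k w" by simp
  show ?case
    unfolding unital_def
  proof (intro allI impI)
    fix J :: "'a set"
    assume J: "cring_ideal J \<and> (\<forall>i<k. (w(p := w p + c * w q)) i \<in> J)"
    then have "w q \<in> J" "w p + c * w q \<in> J" using step by (auto split: if_splits)
    then have "(w p + c * w q) - c * w q \<in> J"
      using J cring_ideal_diff cring_ideal_mult_left by blast
    then have "w p \<in> J" by simp
    with J have "\<forall>i<k. w i \<in> J" by (auto split: if_splits)
    with w J show "1 \<in> J" by (auto simp: unital_def)
  qed
qed

section \<open>Reduction of a unital tuple to a unit vector modulo \<open>I\<close>\<close>

text \<open>Induction on the maximal factors of \<open>I\<close>: entry \<open>p\<close>, already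
  invertible modulo \<open>I\<close>, is moved out of the new factor \<open>M\<close> without losing
  its inverse modulo \<open>I\<close>. The inverses modulo \<open>I\<close> and modulo
  \<open>M\<close> then combine to one modulo the product.\<close>

lemma col_ops_invertible_entry:
  fixes v :: "nat \<Rightarrow> 'a::comm_ring_1"
  assumes "I \<in> maximal_ideal_monoid (class_ring :: 'a ring)" and "unital k v" and "p < k"
  shows "\<exists>w x. col_ops k v w \<and> 1 - w p * x \<in> I"
  using assms(1)
proof induction
  case unit
  show ?case using col_ops.refl by auto
next
  case (mult I M)
  then obtain w x where w: "col_ops k v w" and x: "1 - w p * x \<in> I" by blast
  have I: "cring_ideal I" by (rule maximal_ideal_monoid_ideal) fact
  interpret M: maximalideal M "class_ring :: 'a ring" by fact
  have M: "cring_ideal M" by (rule M.is_ideal)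
  have oneM: "1 \<notin> M" using M.one_imp_carrier M.I_notcarr by auto
  have "\<exists>w' x. col_ops k v w' \<and> 1 - w' p * x \<in> I \<and> w' p \<notin> M"
  proof (cases "w p \<in> M")
    case False
    with w x show ?thesis by blast
  next
    case True
    obtain q where q: "q < k" "w q \<notin> M"
      using unital_col_ops[OF w \<open>unital k v\<close>] M oneM unfolding unital_def by blast
    with True have "p \<noteq> q" by auto
    have "1 - w p * x \<notin> M"
    proof
      assume "1 - w p * x \<in> M"
      then have "(1 - w p * x) + w p * x \<in> M"
        using M True cring_ideal_add cring_ideal_mult_right by blast
      with oneM show False by simp
    qed
    \<comment> \<open>As \<open>?t\<close> lies in \<open>I\<close>, adding \<open>?t * w q\<close>
      keeps \<open>x\<close> an inverse modulo \<open>I\<close>. As neither \<open>?t\<close> nor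
      \<open>w q\<close> lies in the prime ideal \<open>M\<close>, it moves entry \<open>p\<close>
      out of \<open>M\<close>.\<close>
    let ?t = "1 - w p * x"
    let ?w = "w(p := w p + ?t * w q)"
    have "col_ops k v ?w"
      using w q \<open>p < k\<close> \<open>p \<noteq> q\<close> by (intro col_ops.step)
    moreover have "1 - ?w p * x = ?t - ?t * (w q * x)"
      by (simp add: algebra_simps)
    then have "1 - ?w p * x \<in> I"
      using x I by (metis cring_ideal_diff cring_ideal_mult_right)
    moreover have "?w p \<notin> M"
    proof
      assume "?w p \<in> M"
      then have "(w p + ?t * w q) - w p \<in> M"
        using M True by (intro cring_ideal_diff) auto
      then have tq: "?t * w q \<in> M" by simp
      obtain y where y: "1 - w q * y \<in> M"
        using maximal_ideal_inverse[OF \<open>maximalideal M class_ring\<close> q(2)] by blast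
      have "?t = ?t * (1 - w q * y) + (?t * w q) * y"
        by (simp add: algebra_simps)
      then have "?t \<in> M"
        using M tq y by (metis cring_ideal_add cring_ideal_mult_left cring_ideal_mult_right)
      with \<open>?t \<notin> M\<close> show False ..
    qed
    ultimately show ?thesis by blast
  qed
  then obtain w' x' where w': "col_ops k v w'" and x': "1 - w' p * x' \<in> I" and "w' p \<notin> M"
    by blast
  then obtain y where y: "1 - w' p * y \<in> M"
    using maximal_ideal_inverse[OF \<open>maximalideal M class_ring\<close>] by blast
  \<comment> \<open>Expanding this product shows the new inverse,
    \<open>x' + y - w' p * x' * y\<close>. Repeated factors \<open>M\<close> are covered as
    well.\<close>
  have "(1 - w' p * x') * (1 - w' p * y) \<in> I \<cdot>\<^bsub>class_ring\<^esub> M"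
    using ideal_prod.prod[OF x' y, of "class_ring :: 'a ring"] by simp
  moreover have "(1 - w' p * x') * (1 - w' p * y) = 1 - w' p * (x' + y - w' p * x' * y)"
    by (simp add: algebra_simps)
  ultimately show ?case using w' by metis
qed

text \<open>Gaussian elimination with pivot \<open>w i\<close>. The pivot is only congruent to 1, so
  a cleared entry becomes a multiple of \<open>w i - 1\<close>, which lies in \<open>I\<close>,
  rather than 0.\<close>

lemma col_ops_clear:
  fixes w :: "nat \<Rightarrow> 'a::comm_ring_1"
  assumes I: "cring_ideal I" and "i < k" and wi: "w i - 1 \<in> I"
  shows "\<exists>u. col_ops k w u \<and> (\<forall>j<k. u j - (if j = i then 1 else 0) \<in> I)"
proof -
  have "\<exists>u. col_ops k w u \<and> u i = w i \<and> (\<forall>j<m. j \<noteq> i \<longrightarrow> u j \<in> I)" if "m \<le> k" for m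
    using that
  proof (induction m)
    case 0
    show ?case using col_ops.refl by blast
  next
    case (Suc m)
    then obtain u where u: "col_ops k w u" "u i = w i" "\<forall>j<m. j \<noteq> i \<longrightarrow> u j \<in> I" by auto
    show ?case
    proof (cases "m = i")
      case True
      with u show ?thesis by (auto simp: less_Suc_eq)
    next
      case False
      let ?u = "u(m := u m + (- u m) * u i)"
      have "?u m = - u m * (w i - 1)" using u(2) by (simp add: algebra_simps)
      then have "?u m \<in> I" using I wi by (metis cring_ideal_mult_left)
      moreover have "col_ops k w ?u"
        using u(1) Suc.prems False \<open>i < k\<close> by (intro col_ops.step) auto
      moreover have "?u i = w i" "\<forall>j<m. j \<noteq> i \<longrightarrow> ?u j \<in> I"
        using u(2,3) False by auto
      ultimately show ?thesis by (metis less_Suc_eq)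
    qed
  qed
  from this[of k] obtain u where "col_ops k w u" "u i = w i" "\<forall>j<k. j \<noteq> i \<longrightarrow> u j \<in> I"
    by blast
  then show ?thesis using wi by (intro exI[of _ u]) auto
qed

text \<open>A second position \<open>p\<close>, available since \<open>2 \<le> k\<close>, is made
  invertible modulo \<open>I\<close> and used to turn entry \<open>i\<close> into 1 modulo
  \<open>I\<close>. Entry \<open>i\<close> then serves as the pivot that clears the rest, including
  \<open>p\<close>.\<close>

lemma col_ops_unit_vector:
  fixes v :: "nat \<Rightarrow> 'a::comm_ring_1"
  assumes I: "I \<in> maximal_ideal_monoid (class_ring :: 'a ring)" and v: "unital k v"
    and "2 \<le> k" and "i < k"
  shows "\<exists>u. col_ops k v u \<and> (\<forall>j<k. u j - (if j = i then 1 else 0) \<in> I)"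
proof -
  obtain p where p: "p < k" "p \<noteq> i"
  proof (cases "i = 0")
    case True
    with \<open>2 \<le> k\<close> show ?thesis by (intro that[of 1]) auto
  next
    case False
    with \<open>2 \<le> k\<close> show ?thesis by (intro that[of 0]) auto
  qed
  obtain w x where w: "col_ops k v w" and x: "1 - w p * x \<in> I"
    using col_ops_invertible_entry[OF I v p(1)] by blast
  have ideal: "cring_ideal I" using I by (rule maximal_ideal_monoid_ideal)
  \<comment> \<open>Since \<open>x * w p\<close> is 1 modulo \<open>I\<close>, this coefficient adds
    \<open>1 - w i\<close> to entry \<open>i\<close> up to an element of \<open>I\<close>.\<close>
  let ?w = "w(i := w i + (x * (1 - w i)) * w p)"
  have w': "col_ops k v ?w" using w p \<open>i < k\<close> by (intro col_ops.step) auto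
  have "?w i - 1 = - (1 - w i) * (1 - w p * x)" by (simp add: algebra_simps)
  then have "?w i - 1 \<in> I" using ideal x by (metis cring_ideal_mult_left)
  from col_ops_clear[where w = ?w, OF ideal \<open>i < k\<close> this] show ?thesis using w' col_ops_trans by blast
qed

section \<open>Prescribing the rows of a matrix of determinant one\<close>

text \<open>Each row has its own modulus \<open>I i\<close>. Keeping the target as a function of the
  row index makes changing one row a function update.\<close>

definition realizable :: "nat \<Rightarrow> (nat \<Rightarrow> 'a::comm_ring_1 set) \<Rightarrow> (nat \<Rightarrow> nat \<Rightarrow> 'a) \<Rightarrow> bool" where
  "realizable k I f \<longleftrightarrow> (\<exists>A\<in>SL k. \<forall>i<k. \<forall>j<k. A $$ (i, j) - f i j \<in> I i)"

lemma realizable_cong: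
  assumes ideals: "\<And>i. i < k \<Longrightarrow> cring_ideal (I i)"
    and "realizable k I f" and fg: "\<And>i j. i < k \<Longrightarrow> j < k \<Longrightarrow> f i j - g i j \<in> I i"
  shows "realizable k I g"
proof -
  obtain A where A: "A \<in> SL k" "\<And>i j. i < k \<Longrightarrow> j < k \<Longrightarrow> A $$ (i, j) - f i j \<in> I i"
    using assms(2) by (auto simp: realizable_def)
  have "A $$ (i, j) - g i j \<in> I i" if "i < k" "j < k" for i j
    using cring_ideal_add[OF ideals[OF that(1)] A(2)[OF that] fg[OF that]] by simp
  with A(1) show ?thesis by (auto simp: realizable_def)
qed

text \<open>A column operation on \<open>A\<close> affects all rows. Scaling its coefficient by the
  separator \<open>e\<close> makes it act as intended on row \<open>i\<close> modulo
  \<open>I i\<close> and trivially on every other row \<open>l\<close> modulo \<open>I l\<close>,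
  while the determinant stays 1.\<close>

lemma realizable_col_ops:
  fixes I :: "nat \<Rightarrow> 'a::comm_ring_1 set"
  assumes ideals: "\<And>i. i < k \<Longrightarrow> cring_ideal (I i)"
    and comaximal: "\<And>i j. i < k \<Longrightarrow> j < k \<Longrightarrow> i \<noteq> j \<Longrightarrow> I i <+>\<^bsub>class_ring\<^esub> I j = UNIV"
    and f: "realizable k I f" and "i < k" and "col_ops k (f i) w"
  shows "realizable k I (f(i := w))"
  using assms(5)
proof induction
  case refl
  show ?case using f by simp
next
  case (step w p q c)
  then obtain A where A: "A \<in> SL k"
    "\<And>l j. l < k \<Longrightarrow> j < k \<Longrightarrow> A $$ (l, j) - (f(i := w)) l j \<in> I l"
    by (auto simp: realizable_def)
  then have Ac: "A \<in> carrier_mat k k" "det A = 1" by (auto simp: SL_def)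
  obtain e where e: "1 - e \<in> I i" "\<And>j. j < k \<Longrightarrow> j \<noteq> i \<Longrightarrow> e \<in> I j"
    using comaximal_separator[of k I i] ideals comaximal \<open>i < k\<close> by blast
  let ?w = "w(p := w p + c * w q)"
  let ?B = "addcol (c * e) p q A"
  have B: "?B \<in> SL k"
    using Ac step det_addcol[OF step.hyps(3,4) Ac(1)] by (auto simp: SL_def mat_addcol_def)
  have "?B $$ (l, j) - (f(i := ?w)) l j \<in> I l" if lj: "l < k" "j < k" for l j
  proof (cases "j = p")
    case False
    then show ?thesis using A(2)[OF lj] lj Ac by auto
  next
    case True
    have I: "cring_ideal (I l)" using ideals lj by blast
    have Bp: "?B $$ (l, j) = c * e * A $$ (l, q) + A $$ (l, p)" using True lj Ac by auto
    show ?thesis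
    proof (cases "l = i")
      case True
      have *: "A $$ (i, q) - w q \<in> I i" "A $$ (i, p) - w p \<in> I i"
        using A(2)[of i] \<open>i < k\<close> step.hyps by auto
      \<comment> \<open>The error splits into the two old errors of row \<open>i\<close> and the
        defect \<open>1 - e\<close>, all in \<open>I i\<close>.\<close>
      have "?B $$ (l, j) - (f(i := ?w)) l j =
        (A $$ (i, p) - w p) + c * e * (A $$ (i, q) - w q) - c * w q * (1 - e)"
        using Bp True \<open>j = p\<close> by (simp add: algebra_simps)
      also have "\<dots> \<in> I i"
        using * e(1) ideals[OF \<open>i < k\<close>]
        by (meson cring_ideal_diff cring_ideal_add cring_ideal_mult_left)
      finally show ?thesis using True by simp
    next
      case False
      have *: "A $$ (l, p) - f l p \<in> I l" "e \<in> I l"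
        using A(2)[of l p] lj step.hyps e(2) False by auto
      have "?B $$ (l, j) - (f(i := ?w)) l j = (A $$ (l, p) - f l p) + c * A $$ (l, q) * e"
        using Bp False \<open>j = p\<close> by (simp add: algebra_simps)
      also have "\<dots> \<in> I l"
        using * I by (intro cring_ideal_add cring_ideal_mult_left) auto
      finally show ?thesis .
    qed
  qed
  with B show ?case unfolding realizable_def by blast
qed

text \<open>The identity matrix is turned into the target row by row, each row by reversing the
  reduction of \<open>v m\<close> to a unit vector.\<close>

lemma realizable_unital:
  fixes I :: "nat \<Rightarrow> 'a::comm_ring_1 set"
  assumes monoid: "\<And>i. i < k \<Longrightarrow> I i \<in> maximal_ideal_monoid class_ring"
    and comaximal: "\<And>i j. i < k \<Longrightarrow> j < k \<Longrightarrow> i \<noteq> j \<Longrightarrow> I i <+>\<^bsub>class_ring\<^esub> I j = UNIV"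
    and "2 \<le> k" and unital: "\<And>i. i < k \<Longrightarrow> unital k (v i)"
  shows "realizable k I v"
proof -
  have ideals: "cring_ideal (I i)" if "i < k" for i
    using monoid[OF that] by (rule maximal_ideal_monoid_ideal)
  define f where "f m i = (if i < m then v i else (\<lambda>j. if j = i then 1 else 0))" for m i
  have "realizable k I (f m)" if "m \<le> k" for m
    using that
  proof (induction m)
    case 0
    have "(1\<^sub>m k :: 'a mat) \<in> SL k" by (simp add: SL_def)
    moreover have "(1\<^sub>m k :: 'a mat) $$ (i, j) - f 0 i j \<in> I i" if "i < k" "j < k" for i j
      using that ideals[of i] by (auto simp: f_def cring_ideal_zero)
    ultimately show ?case unfolding realizable_def by blast
  next
    case (Suc m)
    then have m: "m < k" by simp
    obtain u where u: "col_ops k (v m) u" "\<forall>j<k. u j - (if j = m then 1 else 0) \<in> I m"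
      using col_ops_unit_vector[OF monoid unital \<open>2 \<le> k\<close>] m by blast
    \<comment> \<open>The reduction ends at \<open>u\<close>, which is only congruent to the unit
      vector, so row \<open>m\<close> is first replaced by \<open>u\<close> and then carried back to
      \<open>v m\<close>.\<close>
    have "realizable k I ((f m)(m := u))"
    proof (rule realizable_cong[OF ideals])
      show "realizable k I (f m)" using Suc by simp
      show "f m i j - ((f m)(m := u)) i j \<in> I i" if "i < k" "j < k" for i j
        using that u(2) cring_ideal_uminus[OF ideals, of m "u j - f m m j"] ideals[of i] m
        by (cases "i = m") (auto simp: f_def cring_ideal_zero split: if_splits)
    qed
    from realizable_col_ops[OF ideals comaximal this m, of "v m"]
    have "realizable k I ((f m)(m := u, m := v m))" using col_ops_sym[OF u(1)] by simp
    moreover have "(f m)(m := u, m := v m) = f (Suc m)"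
      by (auto simp: f_def fun_eq_iff)
    ultimately show ?case by simp
  qed
  then have "realizable k I (f k)" by simp
  then show ?thesis
    by (rule realizable_cong[rotated]) (auto simp: f_def ideals cring_ideal_zero)
qed

section \<open>Surjectivity of the row and column maps\<close>

text \<open>Rows of a matrix in \<open>SL k\<close> are unital, which gives one inclusion. For the
  other, representatives of the given classes are realized as rows up to congruence, which does not
  change the classes.\<close>

lemma sigma1_image:
  fixes I :: "nat \<Rightarrow> 'a::comm_ring_1 set"
  assumes monoid: "\<And>i. i < k \<Longrightarrow> I i \<in> maximal_ideal_monoid class_ring"
    and comaximal: "\<And>i j. i < k \<Longrightarrow> j < k \<Longrightarrow> i \<noteq> j \<Longrightarrow> I i <+>\<^bsub>class_ring\<^esub> I j = UNIV"
    and k: "2 \<le> k"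
  shows "sigma1 k I ` SL k = (\<Pi>\<^sub>E i\<in>{..<k}. PF (k - 1) (I i))"
proof (intro equalityI subsetI)
  have row_unital: "row A i \<in> unital_tuples (k - 1)" if "A \<in> SL k" "i < k" for A :: "'a mat" and i
    using unital_row[OF that] that k by (auto simp: unital_tuples_iff SL_def)
  {
    fix F assume "F \<in> sigma1 k I ` SL k"
    then obtain A where A: "A \<in> SL k" "F = sigma1 k I A" by auto
    have "proj_class (k - 1) (I i) (row A i) \<in> PF (k - 1) (I i)" if "i < k" for i
      using row_unital[OF A(1) that] unfolding proj_class_def PF_def by (rule quotientI)
    then show "F \<in> (\<Pi>\<^sub>E i\<in>{..<k}. PF (k - 1) (I i))" using A(2) by (simp add: sigma1_def)
  next
    fix F assume F: "F \<in> (\<Pi>\<^sub>E i\<in>{..<k}. PF (k - 1) (I i))"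
    have "\<exists>a \<in> unital_tuples (k - 1). F i = proj_class (k - 1) (I i) a" if "i < k" for i
      using PiE_mem[OF F, of i] that unfolding PF_def proj_class_def
      by (metis lessThan_iff quotientE)
    then obtain a where a: "\<And>i. i < k \<Longrightarrow> a i \<in> unital_tuples (k - 1)"
      "\<And>i. i < k \<Longrightarrow> F i = proj_class (k - 1) (I i) (a i)"
      by metis
    have "realizable k I (\<lambda>i. ($) (a i))"
      using a(1) k by (intro realizable_unital monoid comaximal) (auto simp: unital_tuples_iff)
    then obtain A where A: "A \<in> SL k" "\<And>i j. i < k \<Longrightarrow> j < k \<Longrightarrow> A $$ (i, j) - a i $ j \<in> I i"
      by (auto simp: realizable_def)
    have "proj_class (k - 1) (I i) (row A i) = F i" if i: "i < k" for i
    proof -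
      have "row A i $ j - a i $ j \<in> I i" if "j \<le> k - 1" for j
        using A(2)[of i j] A(1) that i k by (auto simp: SL_def)
      then show ?thesis
        using proj_class_cong[OF maximal_ideal_monoid_ideal[OF monoid[OF i]] row_unital[OF A(1) i]
            a(1)[OF i]] a(2)[OF i] by simp
    qed
    \<comment> \<open>Outside \<open>{..<k}\<close> both functions are \<open>undefined\<close>, so
      agreement below \<open>k\<close> suffices.\<close>
    then have "sigma1 k I A = F"
      using F by (intro ext) (auto simp: sigma1_def restrict_def PiE_def extensional_def)
    with A(1) show "F \<in> sigma1 k I ` SL k" by blast
  }
qed

text \<open>Transposition is an involution of \<open>SL k\<close> that exchanges rows and
  columns.\<close>

lemma sigma2_image_eq_sigma1_image: "sigma2 k I ` SL k = sigma1 k I ` SL k"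
proof -
  have transpose: "transpose_mat A \<in> SL k" if "A \<in> SL k" for A :: "'a mat"
    using that by (auto simp: SL_def det_transpose)
  have "sigma2 k I A = sigma1 k I (transpose_mat A)" if "A \<in> SL k" for A :: "'a mat"
    using that unfolding sigma1_def sigma2_def by (intro restrict_ext) (auto simp: SL_def)
  moreover have "transpose_mat ` SL k = (SL k :: 'a mat set)"
    using transpose by (force intro: rev_image_eqI)
  ultimately show ?thesis by (metis (no_types, lifting) image_cong image_image)
qed

theorem mainTheorem3:
  fixes k :: nat and I :: "nat \<Rightarrow> 'a::comm_ring_1 set"
  assumes "dedekind_type_domain (class_ring :: 'a ring)"
    and "k \<ge> 2"
    and "\<And>i. i < k \<Longrightarrow> I i \<in> maximal_ideal_monoid class_ring"
    and "\<And>i j. i < k \<Longrightarrow> j < k \<Longrightarrow> i \<noteq> j \<Longrightarrow> I i <+>\<^bsub>class_ring\<^esub> I j = UNIV"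
  shows "sigma1 k I ` SL k = (\<Pi>\<^sub>E i\<in>{..<k}. PF (k - 1) (I i)) \<and>
         sigma2 k I ` SL k = (\<Pi>\<^sub>E i\<in>{..<k}. PF (k - 1) (I i))"
  using sigma1_image[OF assms(3,4,2)] by (simp add: sigma2_image_eq_sigma1_image)

end
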